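(* Let $\{e_k\}_{k\ge1}$ be the family of polynomials with $\deg(e_k)=k+1$ and $\int_0^1\frac{e_i(t)e_j(t)}{t(1-t)}\,dt=\delta_{ij}$ for all $i,j\ge1$, and suppose each $e_k$ has a positive leading coefficient. Then for $k\ge1$, $$e_{k}(t)=\frac{1}{k}\sqrt{k(k+1)(2k+1)}\;P_{k+1}^{(-1,-1)}(2t-1),\qquad\forall t\in[0,1].$$
   Context: For $\alpha,\beta>-1$, $P_n^{(\alpha,\beta)}$ is the $n$-th degree Jacobi polynomial on $[-1,1]$ with the standard normalization $P_{n}^{(\alpha,\beta)}(x)=\frac{(-1)^{n}}{2^{n}n!}(1-x)^{-\alpha}(1+x)^{-\beta}\frac{d^{n}}{dx^{n}}\big((1-x)^{\alpha+n}(1+x)^{\beta+n}\big)$. For $k\ge2$, $P_k^{(-1,-1)}:=\lim_{\alpha,\beta\to-1^+}P_k^{(\alpha,\beta)}$ (the limit exists uniformly on $[-1,1]$). *)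

theory Defs
  imports "HOL-Analysis.Analysis" "HOL-Computational_Algebra.Polynomial"
begin

definition rodrigues :: "real \<Rightarrow> real \<Rightarrow> nat \<Rightarrow> real \<Rightarrow> real" where
  "rodrigues \<alpha> \<beta> n x =
     (- 1) ^ n / (2 ^ n * fact n) * (1 - x) powr (- \<alpha>) * (1 + x) powr (- \<beta>) *
     (deriv ^^ n) (\<lambda>y. (1 - y) powr (\<alpha> + real n) * (1 + y) powr (\<beta> + real n)) x"

text \<open>
  Rodrigues' formula makes sense only on the open interval, so the Jacobi polynomial is the
  unique polynomial agreeing with it there; see \<open>ex1_jacobi\<close> below.
\<close>

definition jacobi :: "real \<Rightarrow> real \<Rightarrow> nat \<Rightarrow> real poly" where
  "jacobi \<alpha> \<beta> n = (THE p. \<forall>x\<in>{-1<..<1}. poly p x = rodrigues \<alpha> \<beta> n x)"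

text \<open>
  The value at \<open>x\<close> of the polynomial with both parameters equal to \<open>-1\<close>: the joint limit as
  the two parameters tend to \<open>-1\<close> from the right, independently of each other.
\<close>

definition jacobi_m1 :: "nat \<Rightarrow> real \<Rightarrow> real" where
  "jacobi_m1 n x =
     Lim (at_right (- 1) \<times>\<^sub>F at_right (- 1)) (\<lambda>(\<alpha>, \<beta>). poly (jacobi \<alpha> \<beta> n) x)"

lemma deriv_funpow_rodrigues_kernel:
  fixes a b :: real
  shows "\<exists>q. \<forall>x\<in>{-1<..<1}.
    (deriv ^^ k) (\<lambda>y. (1 - y) powr a * (1 + y) powr b) x =
    (1 - x) powr (a - real k) * (1 + x) powr (b - real k) * poly q x"
proof (induction k)
  case 0
  show ?case by (rule exI[of _ 1]) simp
next
  case (Suc k)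
  let ?D = "(deriv ^^ k) (\<lambda>y. (1 - y) powr a * (1 + y) powr b)"
  define c d where "c = a - real k" and "d = b - real k"
  from Suc obtain q where q: "\<And>x. x \<in> {-1<..<1} \<Longrightarrow>
      ?D x = (1 - x) powr c * (1 + x) powr d * poly q x"
    unfolding c_def d_def by blast
  define r where "r = [:1, 0, -1:] * pderiv q + (smult (- c) [:1, 1:] + smult d [:1, -1:]) * q"
  have "deriv ?D x = (1 - x) powr (c - 1) * (1 + x) powr (d - 1) * poly r x"
    if x: "x \<in> {-1<..<1}" for x
  proof -
    have pos: "1 - x > 0" "1 + x > 0" using x by auto
    have "((\<lambda>y. (1 - y) powr c * (1 + y) powr d * poly q y) has_real_derivative
        (1 - x) powr (c - 1) * (1 + x) powr (d - 1) * poly r x) (at x)"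
    proof -
      have e: "(1 - x) powr c = (1 - x) powr (c - 1) * (1 - x)"
              "(1 + x) powr d = (1 + x) powr (d - 1) * (1 + x)"
        using pos by (simp_all add: powr_diff)
      have A: "((\<lambda>y. (1 - y) powr c) has_real_derivative - c * (1 - x) powr (c - 1)) (at x)"
        using pos by (auto intro!: derivative_eq_intros)
      have B: "((\<lambda>y. (1 + y) powr d) has_real_derivative d * (1 + x) powr (d - 1)) (at x)"
        using pos by (auto intro!: derivative_eq_intros)
      show ?thesis
        by (rule DERIV_cong[OF DERIV_mult[OF DERIV_mult[OF A B] poly_DERIV]])
          (simp only: e r_def, simp add: algebra_simps)
    qed
    moreover have "eventually (\<lambda>y. ?D y = (1 - y) powr c * (1 + y) powr d * poly q y) (nhds x)"
      using eventually_nhds_in_open[OF open_greaterThanLessThan x] by eventually_elim (rule q)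
    ultimately have "(?D has_real_derivative
        (1 - x) powr (c - 1) * (1 + x) powr (d - 1) * poly r x) (at x)"
      by (subst DERIV_cong_ev) auto
    thus ?thesis by (rule DERIV_imp_deriv)
  qed
  thus ?case
    by (intro exI[of _ r]) (auto simp: c_def d_def algebra_simps)
qed

lemma ex1_jacobi: "\<exists>!p. \<forall>x\<in>{-1<..<1}. poly p x = rodrigues \<alpha> \<beta> n x"
proof (rule ex_ex1I)
  from deriv_funpow_rodrigues_kernel[of n "\<alpha> + real n" "\<beta> + real n"]
  obtain q where q: "\<And>x. x \<in> {-1<..<1} \<Longrightarrow>
      (deriv ^^ n) (\<lambda>y. (1 - y) powr (\<alpha> + real n) * (1 + y) powr (\<beta> + real n)) x =
      (1 - x) powr \<alpha> * (1 + x) powr \<beta> * poly q x"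
    by auto
  have "poly (smult ((- 1) ^ n / (2 ^ n * fact n)) q) x = rodrigues \<alpha> \<beta> n x"
    if x: "x \<in> {-1<..<1}" for x
    using x unfolding rodrigues_def q[OF x] by (simp add: powr_minus field_simps)
  thus "\<exists>p. \<forall>x\<in>{-1<..<1}. poly p x = rodrigues \<alpha> \<beta> n x" by blast
next
  fix p p' assume "\<forall>x\<in>{-1<..<1}. poly p x = rodrigues \<alpha> \<beta> n x"
    and "\<forall>x\<in>{-1<..<1}. poly p' x = rodrigues \<alpha> \<beta> n x"
  hence "{-1<..<1} \<subseteq> {x. poly (p - p') x = 0}" by auto
  hence "infinite {x. poly (p - p') x = 0}"
    by (rule infinite_super) (simp add: infinite_Ioo)
  thus "p = p'" using poly_roots_finite[of "p - p'"] by (metis right_minus_eq)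
qed

end

theory Submission imports Defs begin

text \<open>
  Write \<open>w = t (1 - t)\<close>. The Jacobi polynomial with both parameters \<open>-1\<close> satisfies Rodrigues'
  formula at these parameters, which on the unit interval reads
  \<open>P\<^sub>k\<^sub>+\<^sub>1(2 t - 1) = (-1)\<^sup>k\<^sup>+\<^sup>1 / (k + 1)! * w * D\<^sup>k\<^sup>+\<^sup>1 w\<^sup>k\<close> (lemma \<open>jacobi_m1_shifted\<close>). To justify it for
  the limit, the Jacobi polynomial is computed by a recursion whose coefficients are polynomial in
  the two parameters. The limit is then an evaluation (\<open>jacobi_m1_eq_rodrigues_poly\<close>), and at the
  parameters \<open>-1\<close> the recursion describes derivatives of an ordinary polynomial
  (\<open>rodrigues_poly_diagonal\<close>).

  The weight \<open>1 / w\<close> is not integrable at \<open>0\<close> and \<open>1\<close>, so finiteness of the norm of \<open>e\<^sub>k\<close> forces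
  \<open>e\<^sub>k = w q\<^sub>k\<close> (\<open>bubble_dvd_if_weighted_square_integrable\<close>), and orthonormality becomes the statement
  that the integral of \<open>w q\<^sub>i q\<^sub>j\<close> is \<open>\<delta>\<^sub>i\<^sub>j\<close>. Here \<open>q\<^sub>k\<close> has degree \<open>k - 1\<close>, so
  the \<open>q\<^sub>j\<close> with \<open>j \<le> k\<close> span the polynomials of degree below \<open>k\<close>.

  Let \<open>R\<^sub>k = D\<^sup>k\<^sup>+\<^sup>1 w\<^sup>k\<close>, which also has degree \<open>k - 1\<close>. Integrating by parts \<open>k + 1\<close> times moves all
  derivatives in the integral of \<open>w p R\<^sub>k\<close> to \<open>w p\<close>, whose degree is too small unless \<open>p\<close> has degree
  at least \<open>k - 1\<close> (\<open>integral01_mult_rodrigues_factor_degree\<close>). Hence \<open>R\<^sub>k\<close> is orthogonal to the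
  earlier \<open>q\<^sub>j\<close> and is a multiple of \<open>q\<^sub>k\<close> (\<open>rodrigues_factor_eq_smult_orthonormal\<close>). The same formula with
  \<open>p = R\<^sub>k\<close> reduces the norm to the Beta integral of \<open>w\<^sup>k\<close> and gives the square of the factor as
  \<open>(k + 1)!\<^sup>2 k / ((k + 1) (2 k + 1))\<close>. Positivity of the leading coefficient of \<open>e\<^sub>k\<close> selects the
  sign.
\<close>

section \<open>The Jacobi polynomial as a polynomial in its parameters\<close>

text \<open>
  Factoring the powers of \<open>1 - y\<close> and \<open>1 + y\<close> out of the \<open>k\<close>-th derivative of
  \<open>(1 - y)\<^sup>a (1 + y)\<^sup>b\<close> leaves a polynomial. The product rule gives this recursion for it, in
  which the exponents \<open>a\<close> and \<open>b\<close> are visible in the coefficients.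
\<close>
primrec rodrigues_poly :: "real \<Rightarrow> real \<Rightarrow> nat \<Rightarrow> real poly" where
  "rodrigues_poly a b 0 = 1"
| "rodrigues_poly a b (Suc k) =
     [:1, 0, -1:] * pderiv (rodrigues_poly a b k) +
     (smult (real k - a) [:1, 1:] + smult (b - real k) [:1, -1:]) * rodrigues_poly a b k"

lemma funpow_deriv_jacobi_weight:
  assumes "x \<in> {-1<..<1}"
  shows "(deriv ^^ k) (\<lambda>y. (1 - y) powr a * (1 + y) powr b) x =
    (1 - x) powr (a - real k) * (1 + x) powr (b - real k) * poly (rodrigues_poly a b k) x"
  using assms
proof (induction k arbitrary: x)
  case 0
  show ?case by simp
next
  case (Suc k)
  let ?D = "(deriv ^^ k) (\<lambda>y. (1 - y) powr a * (1 + y) powr b)"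
  let ?q = "rodrigues_poly a b k"
  define c d where "c = a - real k" and "d = b - real k"
  have pos: "1 - x > 0" "1 + x > 0"
    using Suc.prems by auto
  have ev: "eventually (\<lambda>y. ?D y = (1 - y) powr c * (1 + y) powr d * poly ?q y) (nhds x)"
    using eventually_nhds_in_open[OF open_greaterThanLessThan Suc.prems]
    by eventually_elim (simp only: Suc.IH c_def d_def)
  have "((\<lambda>y. (1 - y) powr c * (1 + y) powr d * poly ?q y) has_real_derivative
      (1 - x) powr (c - 1) * (1 + x) powr (d - 1) * poly (rodrigues_poly a b (Suc k)) x) (at x)"
  proof -
    have L: "((\<lambda>y. (1 - y) powr c) has_real_derivative - c * (1 - x) powr (c - 1)) (at x)"
      using pos by (auto intro!: derivative_eq_intros)
    have R: "((\<lambda>y. (1 + y) powr d) has_real_derivative d * (1 + x) powr (d - 1)) (at x)"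
      using pos by (auto intro!: derivative_eq_intros)
    have lower: "(1 - x) powr c = (1 - x) powr (c - 1) * (1 - x)"
      "(1 + x) powr d = (1 + x) powr (d - 1) * (1 + x)"
      using pos by (simp_all add: powr_diff)
    have sh: "real k - a = - c" "b - real k = d"
      by (simp_all add: c_def d_def)
    show ?thesis
      by (rule DERIV_cong[OF DERIV_mult[OF DERIV_mult[OF L R] poly_DERIV]])
        (simp only: lower rodrigues_poly.simps sh, simp add: algebra_simps)
  qed
  then have "deriv ?D x =
      (1 - x) powr (c - 1) * (1 + x) powr (d - 1) * poly (rodrigues_poly a b (Suc k)) x"
    by (intro DERIV_imp_deriv) (simp only: DERIV_cong_ev[OF refl ev refl])
  thus ?case
    by (simp add: c_def d_def algebra_simps del: rodrigues_poly.simps)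
qed

lemma jacobi_eq_rodrigues_poly:
  "jacobi \<alpha> \<beta> n =
     smult ((- 1) ^ n / (2 ^ n * fact n)) (rodrigues_poly (\<alpha> + real n) (\<beta> + real n) n)"
  unfolding jacobi_def
proof (rule the1_equality[OF ex1_jacobi], rule ballI)
  fix x :: real assume x: "x \<in> {-1<..<1}"
  then show "poly (smult ((- 1) ^ n / (2 ^ n * fact n))
      (rodrigues_poly (\<alpha> + real n) (\<beta> + real n) n)) x = rodrigues \<alpha> \<beta> n x"
    unfolding rodrigues_def funpow_deriv_jacobi_weight[OF x] by (simp add: powr_minus field_simps)
qed

text \<open>
  A bound independent of \<open>a\<close> and \<open>b\<close> makes the values finite sums over a fixed set of
  coefficients, so that limits in the parameters can be taken coefficientwise. The bound is crude:
  the degree is in fact at most \<open>k\<close>.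
\<close>
lemma degree_rodrigues_poly: "degree (rodrigues_poly a b k) \<le> 2 * k"
proof (induction k)
  case (Suc k)
  let ?q = "rodrigues_poly a b k"
  have "degree ([:1, 0, -1:] * pderiv ?q) \<le> 2 * Suc k"
    by (rule order.trans[OF degree_mult_le]) (use Suc.IH in \<open>simp add: degree_pderiv\<close>)
  moreover have "degree ((smult (real k - a) [:1, 1:] + smult (b - real k) [:1, -1:]) * ?q)
      \<le> 2 * Suc k"
    by (rule order.trans[OF degree_mult_le]) (use Suc.IH in simp)
  ultimately show ?case
    unfolding rodrigues_poly.simps(2) by (rule degree_add_le)
qed simp

lemma tendsto_coeff_rodrigues_poly:
  assumes "(a \<longlongrightarrow> A) F" "(b \<longlongrightarrow> B) F"
  shows "((\<lambda>s. coeff (rodrigues_poly (a s) (b s) k) i) \<longlongrightarrow> coeff (rodrigues_poly A B k) i) F"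
proof (induction k arbitrary: i)
  case 0
  show ?case by simp
next
  case (Suc k)
  have pc: "((\<lambda>s. coeff (pCons (0::real) (f s)) i) \<longlongrightarrow> coeff (pCons 0 g) i) F"
    if "\<And>i. ((\<lambda>s. coeff (f s) i) \<longlongrightarrow> coeff g i) F" for f g i
    using that by (cases i) auto
  have "rodrigues_poly a b (Suc k) =
      pderiv (rodrigues_poly a b k) - pCons 0 (pCons 0 (pderiv (rodrigues_poly a b k))) +
      smult (real k - a) (rodrigues_poly a b k + pCons 0 (rodrigues_poly a b k)) +
      smult (b - real k) (rodrigues_poly a b k - pCons 0 (rodrigues_poly a b k))" for a b
  proof -
    have "[:1, 0, -1:] * q = q - pCons 0 (pCons 0 q)" "[:1, 1:] * q = q + pCons 0 q"
      "[:1, -1:] * q = q - pCons 0 q" for q :: "real poly"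
      by simp_all
    then show ?thesis
      by (simp only: rodrigues_poly.simps distrib_right mult_smult_left add.assoc)
  qed
  then show ?case
    by (simp only: coeff_add coeff_diff coeff_smult)
      (intro tendsto_intros pc assms Suc.IH; simp only: coeff_pderiv; intro tendsto_intros Suc.IH)
qed

lemma tendsto_poly_rodrigues_poly:
  assumes "(a \<longlongrightarrow> A) F" "(b \<longlongrightarrow> B) F"
  shows "((\<lambda>s. poly (rodrigues_poly (a s) (b s) k) x) \<longlongrightarrow> poly (rodrigues_poly A B k) x) F"
proof -
  have "poly (rodrigues_poly a b k) x = (\<Sum>i\<le>2 * k. coeff (rodrigues_poly a b k) i * x ^ i)" for a b
    using arg_cong[OF poly_as_sum_of_monoms'[OF degree_rodrigues_poly[of a b k]], of "\<lambda>p. poly p x"]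
    by (simp add: poly_sum poly_monom)
  then show ?thesis
    by (simp only:) (intro tendsto_intros tendsto_coeff_rodrigues_poly assms)
qed

text \<open>
  The coefficients of the Jacobi polynomial are continuous functions of its parameters, even across
  the value \<open>-1\<close>, so the limit is just the value of the explicit polynomial there. With
  \<open>\<alpha> = \<beta> = -1\<close> the exponents \<open>\<alpha> + n\<close> and \<open>\<beta> + n\<close> are \<open>n - 1\<close>.
\<close>
lemma jacobi_m1_eq_rodrigues_poly:
  "jacobi_m1 n x =
     (- 1) ^ n / (2 ^ n * fact n) * poly (rodrigues_poly (real n - 1) (real n - 1) n) x"
  unfolding jacobi_m1_def
proof (rule tendsto_Lim)
  let ?F = "at_right (- 1 :: real) \<times>\<^sub>F at_right (- 1 :: real)"
  show "?F \<noteq> bot"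
    by (simp add: prod_filter_eq_bot)
  have "(fst \<longlongrightarrow> - 1) ?F" "(snd \<longlongrightarrow> - 1) ?F"
    using filterlim_compose[OF tendsto_ident_at filterlim_fst]
      filterlim_compose[OF tendsto_ident_at filterlim_snd] by blast+
  then have "((\<lambda>s. poly (rodrigues_poly (fst s + real n) (snd s + real n) n) x)
      \<longlongrightarrow> poly (rodrigues_poly (- 1 + real n) (- 1 + real n) n) x) ?F"
    by (intro tendsto_poly_rodrigues_poly tendsto_intros)
  then show "((\<lambda>(\<alpha>, \<beta>). poly (jacobi \<alpha> \<beta> n) x) \<longlongrightarrow>
      (- 1) ^ n / (2 ^ n * fact n) * poly (rodrigues_poly (real n - 1) (real n - 1) n) x) ?F"
    by (simp only: jacobi_eq_rodrigues_poly case_prod_beta' poly_smult)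
      (intro tendsto_intros; simp add: add.commute)
qed

section \<open>Rodrigues' formula at the exceptional parameters\<close>

text \<open>
  When both exponents equal a natural number, the kernel is itself a polynomial and Rodrigues'
  formula becomes an identity between polynomials. Multiplying by the power of \<open>1 - x\<^sup>2\<close> avoids the
  negative exponents that occur once \<open>k\<close> exceeds \<open>m\<close>, which is the case of interest.
\<close>
lemma rodrigues_poly_same_nat:
  "[:1, 0, -1:] ^ k * (pderiv ^^ k) ([:1, 0, -1:] ^ m) =
     [:1, 0, -1:] ^ m * rodrigues_poly (real m) (real m) k"
proof (induction k)
  case 0
  show ?case by simp
next
  case (Suc k)
  define W :: "real poly" where "W = [:1, 0, -1:]"
  define Q where "Q = rodrigues_poly (real m) (real m) k"
  \<comment> \<open>Multiplied by \<open>W\<close>, the derivative of a power needs no predecessor in the exponent.\<close>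
  have dpow: "W * pderiv (W ^ j) = smult (real j) (W ^ j * pderiv W)" for j
    by (cases j) (simp_all add: pderiv_power_Suc mult_ac del: of_nat_Suc power_Suc, simp add: mult_ac)
  have IH: "W ^ k * (pderiv ^^ k) (W ^ m) = W ^ m * Q"
    using Suc.IH by (simp add: W_def Q_def)
  have "W * (W ^ k * pderiv ((pderiv ^^ k) (W ^ m)))
      = W * pderiv (W ^ k * (pderiv ^^ k) (W ^ m)) - (W * pderiv (W ^ k)) * (pderiv ^^ k) (W ^ m)"
    by (simp add: pderiv_mult algebra_simps)
  also have "(W * pderiv (W ^ k)) * (pderiv ^^ k) (W ^ m)
      = smult (real k) (pderiv W * (W ^ k * (pderiv ^^ k) (W ^ m)))"
    unfolding dpow by (simp add: mult_ac)
  also have "\<dots> = smult (real k) (pderiv W * (W ^ m * Q))"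
    unfolding IH ..
  also have "W * pderiv (W ^ k * (pderiv ^^ k) (W ^ m)) = W * pderiv (W ^ m * Q)"
    unfolding IH ..
  also have "\<dots> = W ^ m * (W * pderiv Q) + (W * pderiv (W ^ m)) * Q"
    by (simp add: pderiv_mult algebra_simps)
  also have "(W * pderiv (W ^ m)) * Q = smult (real m) (pderiv W * (W ^ m * Q))"
    unfolding dpow by (simp add: mult_ac)
  also have "W ^ m * (W * pderiv Q) + smult (real m) (pderiv W * (W ^ m * Q)) -
      smult (real k) (pderiv W * (W ^ m * Q)) =
      W ^ m * (W * pderiv Q + smult (real m - real k) (pderiv W) * Q)"
    by (simp add: algebra_simps smult_diff_left)
  also have "smult (real m - real k) (pderiv W) =
      smult (real k - real m) [:1, 1:] + smult (real m - real k) [:1, -1:]"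
    by (simp add: W_def pderiv_pCons)
  finally show ?case
    by (simp only: rodrigues_poly.simps(2) power_Suc funpow.simps(2) o_apply mult.assoc
        flip: W_def Q_def)
qed

lemma rodrigues_poly_diagonal:
  "rodrigues_poly (real m) (real m) (Suc m) =
     [:1, 0, -1:] * (pderiv ^^ Suc m) ([:1, 0, -1:] ^ m)"
proof -
  have "[:1, 0, -1::real:] ^ m * ([:1, 0, -1:] * (pderiv ^^ Suc m) ([:1, 0, -1:] ^ m)) =
      [:1, 0, -1:] ^ m * rodrigues_poly (real m) (real m) (Suc m)"
    using rodrigues_poly_same_nat[of "Suc m" m] by (simp only: power_Suc mult_ac)
  then show ?thesis
    by (subst (asm) mult_cancel_left) simp
qed

lemma higher_pderiv_pcompose_linear:
  fixes p :: "real poly"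
  shows "(pderiv ^^ n) (pcompose p [:b, a:]) = smult (a ^ n) (pcompose ((pderiv ^^ n) p) [:b, a:])"
  by (induction n) (simp_all add: pderiv_smult pderiv_pcompose pderiv_pCons mult.commute)

section \<open>Transfer to the unit interval\<close>

text \<open>
  The polynomial \<open>t (1 - t)\<close>, whose reciprocal is the weight of the inner product. The name is that
  of the finite element literature, for a function vanishing at both ends of the element.
\<close>
definition bubble :: "real poly" where
  "bubble = [:0, 1, -1:]"

lemma poly_bubble: "poly bubble t = t * (1 - t)"
  by (simp add: bubble_def algebra_simps)

lemma bubble_nonzero: "bubble \<noteq> 0"
  by (simp add: bubble_def)

lemma degree_bubble: "degree bubble = 2"
  by (simp add: bubble_def)

lemma lead_coeff_bubble: "lead_coeff bubble = - 1"
  by (simp add: bubble_def)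

text \<open>
  What remains of the Jacobi polynomial with parameters \<open>-1\<close> and index \<open>k + 1\<close>, moved to the unit
  interval, after division by \<open>t (1 - t)\<close> and up to normalisation. It is a multiple of the derivative
  of the shifted Legendre polynomial of degree \<open>k\<close>.
\<close>
definition rodrigues_factor :: "nat \<Rightarrow> real poly" where
  "rodrigues_factor k = (pderiv ^^ Suc k) (bubble ^ k)"

text \<open>
  Under \<open>x = 2 t - 1\<close> one has \<open>1 - x\<^sup>2 = 4 t (1 - t)\<close>, and each derivative in \<open>x\<close> costs a factor
  \<open>1 / 2\<close>. The resulting powers of two are exactly those in Rodrigues' normalisation.
\<close>
lemma jacobi_m1_shifted:
  "jacobi_m1 (Suc k) (2 * t - 1) =
     (- 1) ^ Suc k / fact (Suc k) * poly (bubble * rodrigues_factor k) t"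
proof -
  let ?l = "[:-1, 2:] :: real poly"
  define W :: "real poly" where "W = [:1, 0, -1:]"
  have W: "pcompose W ?l = smult 4 bubble"
    by (simp add: W_def bubble_def pcompose_pCons)
  have pw: "pcompose (p ^ j) q = pcompose p q ^ j" for p q :: "real poly" and j
    by (induction j) (simp_all add: pcompose_mult one_pCons)
  have "smult (2 ^ Suc k) (pcompose ((pderiv ^^ Suc k) (W ^ k)) ?l)
      = (pderiv ^^ Suc k) (pcompose (W ^ k) ?l)"
    by (rule higher_pderiv_pcompose_linear[symmetric])
  also have "\<dots> = smult (4 ^ k) (rodrigues_factor k)"
    by (simp only: pw W smult_power higher_pderiv_smult rodrigues_factor_def)
  finally have D: "2 ^ Suc k * poly ((pderiv ^^ Suc k) (W ^ k)) (2 * t - 1) =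
      4 ^ k * poly (rodrigues_factor k) t"
    by (metis (no_types, opaque_lifting) poly_pcompose poly_smult poly_pCons poly_0 mult_zero_right
        add_0_right mult.commute uminus_add_conv_diff)
  have "poly W (2 * t - 1) = 4 * poly bubble t"
    by (simp add: W_def bubble_def algebra_simps)
  moreover have "(4::real) * 4 ^ k = 2 ^ Suc k * 2 ^ Suc k"
    by (simp flip: power_mult_distrib)
  ultimately have "2 ^ Suc k * (poly W (2 * t - 1) * poly ((pderiv ^^ Suc k) (W ^ k)) (2 * t - 1))
      = 2 ^ Suc k * (2 ^ Suc k * poly (bubble * rodrigues_factor k) t)"
    using D by (metis mult.assoc mult.left_commute poly_mult)
  then have "poly (W * (pderiv ^^ Suc k) (W ^ k)) (2 * t - 1)
      = 2 ^ Suc k * poly (bubble * rodrigues_factor k) t"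
    by (metis mult_left_cancel poly_mult power_not_zero zero_neq_numeral)
  moreover have "rodrigues_poly (real (Suc k) - 1) (real (Suc k) - 1) (Suc k) =
      W * (pderiv ^^ Suc k) (W ^ k)"
    using rodrigues_poly_diagonal[of k] by (simp add: W_def del: funpow.simps rodrigues_poly.simps)
  ultimately show ?thesis
    by (simp only: jacobi_m1_eq_rodrigues_poly) (simp del: funpow.simps power_Suc)
qed

section \<open>Orthogonality by repeated integration by parts\<close>

lemma poly_integrable_01: "(poly (p :: real poly)) integrable_on {0..1}"
  by (intro integrable_continuous_real continuous_intros)

definition integral01 :: "real poly \<Rightarrow> real" where
  "integral01 p = integral {0..1} (poly p)"

lemma integral01_add: "integral01 (p + q) = integral01 p + integral01 q"
proof -
  have "poly (p + q) = (\<lambda>t. poly p t + poly q t)"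
    by auto
  then show ?thesis
    by (simp add: integral01_def integral_add poly_integrable_01)
qed

lemma integral01_smult: "integral01 (smult c p) = c * integral01 p"
proof -
  have "poly (smult c p) = (\<lambda>t. c * poly p t)"
    by auto
  then show ?thesis
    by (simp add: integral01_def)
qed

lemma integral01_minus: "integral01 (- p) = - integral01 p"
  using integral01_smult[of "- 1" p] by simp

lemma integral01_0 [simp]: "integral01 0 = 0"
  using integral01_smult[of 0 0] by simp

lemma integral01_sum: "integral01 (\<Sum>i\<in>I. f i) = (\<Sum>i\<in>I. integral01 (f i))"
  by (induction I rule: infinite_finite_induct) (simp_all add: integral01_add)

lemma integral01_pderiv: "integral01 (pderiv p) = poly p 1 - poly p 0"
proof -
  have "(poly (pderiv p) has_integral poly p 1 - poly p 0) {0..1}"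
    by (rule fundamental_theorem_of_calculus)
      (auto intro!: DERIV_subset[OF poly_DERIV]
        simp: has_real_derivative_iff_has_vector_derivative[symmetric])
  then show ?thesis
    unfolding integral01_def by (rule integral_unique)
qed

lemma integral01_by_parts:
  assumes "poly (p * q) 0 = 0" "poly (p * q) 1 = 0"
  shows "integral01 (p * pderiv q) = - integral01 (pderiv p * q)"
proof -
  have "integral01 (p * pderiv q) + integral01 (pderiv p * q) = integral01 (pderiv (p * q))"
    by (simp add: pderiv_mult mult.commute flip: integral01_add)
  with assms show ?thesis
    by (simp only: integral01_pderiv)
qed

lemma power_dvd_higher_pderiv:
  fixes w :: "real poly"
  assumes "i \<le> k"
  shows "w ^ (k - i) dvd (pderiv ^^ i) (w ^ k)"
  using assms
proof (induction i)
  case (Suc i)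
  then obtain r where r: "(pderiv ^^ i) (w ^ k) = w ^ Suc (k - Suc i) * r"
    by (metis Suc_diff_Suc Suc_leD Suc_le_lessD dvdE)
  have "pderiv (w ^ Suc n * r) = w ^ n * (smult (real (Suc n)) (pderiv w) * r + w * pderiv r)" for n
    unfolding pderiv_mult pderiv_power_Suc by (simp add: algebra_simps)
  then show ?case
    by (simp only: funpow.simps(2) o_apply r dvd_triv_left)
qed simp

text \<open>
  The boundary terms vanish because fewer than \<open>k\<close> derivatives of \<open>(t (1 - t))\<^sup>k\<close> still leave a
  factor \<open>t (1 - t)\<close>.
\<close>
lemma integral01_shift_derivatives:
  assumes "i \<le> k"
  shows "integral01 (p * (pderiv ^^ i) (bubble ^ k)) =
    (- 1) ^ i * integral01 ((pderiv ^^ i) p * bubble ^ k)"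
  using assms
proof (induction i arbitrary: p)
  case (Suc i)
  then have "bubble dvd (pderiv ^^ i) (bubble ^ k)"
    by (metis Suc_leD Suc_le_lessD dvd_power dvd_trans power_dvd_higher_pderiv zero_less_diff)
  then have "poly ((pderiv ^^ i) (bubble ^ k)) 0 = 0" "poly ((pderiv ^^ i) (bubble ^ k)) 1 = 0"
    by (auto elim!: dvdE simp: poly_bubble)
  then have "integral01 (p * (pderiv ^^ Suc i) (bubble ^ k)) =
      - integral01 (pderiv p * (pderiv ^^ i) (bubble ^ k))"
    by (simp add: integral01_by_parts)
  also have "\<dots> = (- 1) ^ Suc i * integral01 ((pderiv ^^ Suc i) p * bubble ^ k)"
    using Suc by (simp add: funpow_swap1)
  finally show ?case .
qed simp

text \<open>
  One integration by parts more than in the previous lemma: the \<open>k\<close>-th derivative of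
  \<open>(t (1 - t))\<^sup>k\<close> no longer vanishes at the ends, but the other factor does.
\<close>
lemma integral01_mult_rodrigues_factor:
  "integral01 (bubble * p * rodrigues_factor k) =
     (- 1) ^ Suc k * integral01 ((pderiv ^^ Suc k) (bubble * p) * bubble ^ k)"
proof -
  have "integral01 (bubble * p * pderiv ((pderiv ^^ k) (bubble ^ k))) =
      - integral01 (pderiv (bubble * p) * (pderiv ^^ k) (bubble ^ k))"
    by (rule integral01_by_parts) (simp_all add: poly_bubble)
  then show ?thesis
    by (simp add: integral01_shift_derivatives rodrigues_factor_def funpow_swap1)
qed

lemma higher_pderiv_degree_le:
  fixes p :: "real poly"
  assumes "degree p \<le> n"
  shows "(pderiv ^^ n) p = [:fact n * coeff p n:]"
proof (rule poly_eqI)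
  fix i
  show "coeff ((pderiv ^^ n) p) i = coeff [:fact n * coeff p n:] i"
    using assms by (cases i) (simp_all add: coeff_higher_pderiv pochhammer_fact coeff_eq_0)
qed

text \<open>
  After all derivatives have been moved, only the top coefficient of \<open>p\<close> survives. For
  \<open>degree p < k - 1\<close> this is the orthogonality relation, and for \<open>degree p = k - 1\<close> it computes the
  norm.
\<close>
lemma integral01_mult_rodrigues_factor_degree:
  assumes "degree p < k"
  shows "integral01 (bubble * p * rodrigues_factor k) =
    (- 1) ^ k * fact (Suc k) * coeff p (k - 1) * integral01 (bubble ^ k)"
proof -
  have deg: "degree (bubble * p) \<le> Suc k"
    using assms degree_mult_le[of bubble p] by (simp add: degree_bubble)
  obtain m where "k = Suc m"
    using assms by (cases k) auto
  then have "coeff (bubble * p) (Suc k) = - coeff p (k - 1)"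
    using assms by (simp add: bubble_def coeff_eq_0)
  then show ?thesis
    unfolding integral01_mult_rodrigues_factor higher_pderiv_degree_le[OF deg]
    by (simp add: integral01_smult integral01_minus)
qed

text \<open>
  This is Euler's Beta integral with both arguments equal to \<open>k + 1\<close>.
\<close>
lemma integral01_bubble_power: "integral01 (bubble ^ k) = (fact k)\<^sup>2 / fact (2 * k + 1)"
proof -
  \<comment> \<open>On the open interval both bases are positive, so \<open>powr\<close> agrees with \<open>^\<close> also for \<open>k = 0\<close>.\<close>
  have "((\<lambda>t. t powr (real (Suc k) - 1) * (1 - t) powr (real (Suc k) - 1))
      has_integral Beta (real (Suc k)) (real (Suc k))) {0<..<1}"
    using has_integral_Beta_real[of "real (Suc k)" "real (Suc k)"]
    by (simp add: has_integral_Icc_iff_Ioo)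
  also have "?this \<longleftrightarrow>
      (poly (bubble ^ k) has_integral Beta (real (Suc k)) (real (Suc k))) {0<..<1}"
    by (intro has_integral_cong) (simp add: poly_bubble powr_realpow power_mult_distrib)
  finally have "integral01 (bubble ^ k) = Beta (real (Suc k)) (real (Suc k))"
    unfolding integral01_def by (intro integral_unique) (simp add: has_integral_Icc_iff_Ioo)
  also have "\<dots> = (fact k)\<^sup>2 / fact (2 * k + 1)"
  proof -
    have "Gamma (real (Suc k)) = fact k"
      using Gamma_fact[of k, where 'a = real] by (simp add: add.commute)
    moreover have "Gamma (real (Suc k) + real (Suc k)) = fact (2 * k + 1)"
      using Gamma_fact[of "2 * k + 1", where 'a = real] by (simp add: algebra_simps)
    ultimately show ?thesis
      by (simp only: Beta_def power2_eq_square)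
  qed
  finally show ?thesis .
qed

lemma degree_rodrigues_factor:
  assumes "k \<ge> 1"
  shows "degree (rodrigues_factor k) = k - 1"
  using assms by (simp add: rodrigues_factor_def degree_higher_pderiv degree_power_eq bubble_nonzero
      degree_bubble del: funpow.simps)

lemma coeff_rodrigues_factor:
  assumes "k \<ge> 1"
  shows "coeff (rodrigues_factor k) (k - 1) = (- 1) ^ k * (fact (2 * k) / fact (k - 1))"
proof -
  have "degree (bubble ^ k) = 2 * k"
    by (simp add: degree_power_eq bubble_nonzero degree_bubble)
  then have "coeff (bubble ^ k) (2 * k) = (- 1) ^ k"
    by (metis lead_coeff_bubble lead_coeff_power)
  moreover have "pochhammer (real (Suc (k - 1))) (Suc k) = fact (2 * k) / fact (k - 1)"
    using assms pochhammer_product'[of "1::real" "k - 1" "Suc k"]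
    by (simp add: nonzero_eq_divide_eq mult_2 flip: pochhammer_fact)
  moreover have "k - 1 + Suc k = 2 * k"
    using assms by simp
  ultimately show ?thesis
    by (simp only: rodrigues_factor_def coeff_higher_pderiv mult.commute)
qed

lemma integral01_rodrigues_factor_square:
  assumes "k \<ge> 1"
  shows "integral01 (bubble * rodrigues_factor k * rodrigues_factor k) =
    (fact (Suc k))\<^sup>2 * (real k / ((real k + 1) * (2 * real k + 1)))"
proof -
  obtain m where k: "k = Suc m"
    using assms by (cases k) auto
  have deg: "degree (rodrigues_factor k) < k"
    using assms by (simp add: degree_rodrigues_factor)
  have sign: "(- 1 :: real) ^ k * ((- 1) ^ k * z) = z" for z
    by (simp flip: power_mult_distrib mult.assoc)
  have "integral01 (bubble * rodrigues_factor k * rodrigues_factor k) =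
      fact (Suc k) * (fact (2 * k) / fact (k - 1)) * ((fact k)\<^sup>2 / fact (2 * k + 1))"
    using assms sign
    by (simp only: integral01_mult_rodrigues_factor_degree[OF deg] coeff_rodrigues_factor[OF assms]
        integral01_bubble_power) (simp add: mult_ac)
  also have "\<dots> = (fact (Suc k))\<^sup>2 * (real k / ((real k + 1) * (2 * real k + 1)))"
    unfolding k by (simp add: divide_simps power2_eq_square) (simp add: algebra_simps)?
  finally show ?thesis .
qed

section \<open>Uniqueness of the orthonormal family\<close>

text \<open>
  Successive removal of the top coefficient. The hypothesis on \<open>p\<close> speaks of coefficients and not of
  the degree so that it also covers \<open>p = 0\<close>, in particular when \<open>n = 0\<close>.
\<close>
lemma polynomial_graded_basis:
  fixes q :: "nat \<Rightarrow> real poly"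
  assumes "\<And>j. degree (q j) = j" "\<And>j. q j \<noteq> 0"
  assumes "\<And>i. i \<ge> n \<Longrightarrow> coeff p i = 0"
  shows "\<exists>c. p = (\<Sum>j<n. smult (c j) (q j))"
  using assms(3)
proof (induction n arbitrary: p)
  case 0
  then have "p = 0" by (intro poly_eqI) simp
  then show ?case by simp
next
  case (Suc n)
  define a where "a = coeff p n / coeff (q n) n"
  have "coeff (q n) n \<noteq> 0"
    using assms(1,2)[of n] by (metis leading_coeff_0_iff)
  then have "coeff (p - smult a (q n)) i = 0" if "i \<ge> n" for i
    using that Suc.prems[of i] assms(1)[of n]
    by (cases "i = n") (simp_all add: a_def coeff_eq_0)
  from Suc.IH[OF this] obtain c where c: "p - smult a (q n) = (\<Sum>j<n. smult (c j) (q j))"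
    by blast
  have "p = (\<Sum>j<Suc n. smult ((c(n := a)) j) (q j))"
    using c by (simp add: algebra_simps)
  then show ?case by blast
qed

text \<open>
  An antiderivative is \<open>a ln t - b ln (1 - t)\<close>, so the integral over \<open>[d, 1 - d]\<close> is
  \<open>(a + b) ln ((1 - d) / d)\<close>, which is unbounded as \<open>d\<close> tends to \<open>0\<close>. Treating both ends at once
  spares a separate argument by reflection.
\<close>
lemma not_integrable_inverse_bubble:
  fixes a b :: real
  assumes "a \<ge> 0" "b \<ge> 0" and int: "(\<lambda>t. a / t + b / (1 - t)) integrable_on {0..1}"
  shows "a = 0 \<and> b = 0"
proof (rule ccontr)
  assume "\<not> (a = 0 \<and> b = 0)"
  with assms have ab: "a + b > 0" by auto
  let ?f = "\<lambda>t. a / t + b / (1 - t)"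
  define M where "M = integral {0..1} ?f"
  have nonneg: "?f t \<ge> 0" if "t \<in> {0..1}" for t
    using that assms by simp
  then have M: "M \<ge> 0"
    unfolding M_def by (intro integral_nonneg int)
  \<comment> \<open>Chosen so that the integral over \<open>[d, 1 - d]\<close> is exactly \<open>M + 1\<close>: \<open>ln ((1 - d) / d) = s\<close>.\<close>
  define s where "s = (M + 1) / (a + b)"
  define d where "d = 1 / (1 + exp s)"
  have s: "s > 0"
    using M ab by (simp add: s_def)
  have d: "0 < d" "d < 1 - d"
    using s by (simp_all add: d_def add_pos_pos field_simps)
  have "(?f has_integral ((a * ln (1 - d) - b * ln (1 - (1 - d))) - (a * ln d - b * ln (1 - d))))
      {d..1 - d}"
    using d by (intro fundamental_theorem_of_calculus)
      (auto intro!: derivative_eq_intros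
        simp: has_real_derivative_iff_has_vector_derivative[symmetric])
  also have "(a * ln (1 - d) - b * ln (1 - (1 - d))) - (a * ln d - b * ln (1 - d)) =
      (a + b) * (ln (1 - d) - ln d)"
    by (simp add: algebra_simps)
  also have "ln (1 - d) - ln d = s"
  proof -
    have "(1 - d) / d = exp s"
      using add_pos_pos[OF zero_less_one exp_gt_zero[of s]] by (simp add: d_def field_simps)
    moreover have "ln ((1 - d) / d) = ln (1 - d) - ln d"
      using d by (simp add: ln_div)
    ultimately show ?thesis
      by simp
  qed
  also have "(a + b) * s = M + 1"
    using ab by (simp add: s_def)
  finally have I: "(?f has_integral M + 1) {d..1 - d}" .
  have "integral {d..1 - d} ?f \<le> integral {0..1} ?f"
    using d I int nonneg by (intro integral_subset_le) auto
  with I show False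
    by (simp add: integral_unique M_def)
qed

lemma bubble_dvd:
  fixes p :: "real poly"
  assumes "poly p 0 = 0" "poly p 1 = 0"
  shows "bubble dvd p"
proof -
  obtain q where q: "p = [:0, 1:] * q"
    using assms(1) by (metis dvdE minus_zero poly_eq_0_iff_dvd)
  with assms(2) have "poly q 1 = 0" by simp
  then obtain r where "q = [:- 1, 1:] * r"
    by (metis dvdE poly_eq_0_iff_dvd)
  with q have "p = bubble * (- r)"
    by (simp add: bubble_def algebra_simps)
  then show ?thesis by simp
qed

text \<open>
  A member of the family has finite norm, and this forces it to vanish at both ends. By partial
  fractions the integrand is \<open>p(0)\<^sup>2 / t + p(1)\<^sup>2 / (1 - t)\<close> plus a polynomial, and the first two terms
  are not integrable unless both numerators are zero.
\<close>
lemma bubble_dvd_if_weighted_square_integrable: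
  fixes p :: "real poly"
  assumes "(\<lambda>t. poly p t * poly p t / (t * (1 - t))) integrable_on {0..1}"
  shows "bubble dvd p"
proof -
  define a b where "a = (poly p 0)\<^sup>2" and "b = (poly p 1)\<^sup>2"
  \<comment> \<open>\<open>[:a, b - a:]\<close> interpolates the square of \<open>p\<close> linearly at \<open>0\<close> and \<open>1\<close>.\<close>
  have "bubble dvd p * p - [:a, b - a:]"
    by (rule bubble_dvd) (simp_all add: a_def b_def power2_eq_square)
  then obtain r where r: "p * p - [:a, b - a:] = bubble * r" ..
  have int: "(\<lambda>t. poly p t * poly p t / (t * (1 - t)) - poly r t) integrable_on {0..1}"
    by (intro integrable_diff assms poly_integrable_01)
  have "a / t + b / (1 - t) = poly p t * poly p t / (t * (1 - t)) - poly r t"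
    if "t \<in> {0..1} - {0, 1}" for t
  proof -
    have "poly p t * poly p t = a * (1 - t) + b * t + t * (1 - t) * poly r t"
      using arg_cong[OF r, of "\<lambda>q. poly q t"] by (simp add: poly_bubble algebra_simps)
    with that show ?thesis by (simp add: field_simps)
  qed
  then have "(\<lambda>t. a / t + b / (1 - t)) integrable_on {0..1}"
    by (intro integrable_spike_finite[OF _ _ int, of "{0, 1}"]) auto
  then have "a = 0 \<and> b = 0"
    by (intro not_integrable_inverse_bubble) (simp_all add: a_def b_def)
  then show ?thesis
    by (intro bubble_dvd) (simp_all add: a_def b_def)
qed

text \<open>
  Expand the Rodrigues factor in \<open>q 0, ..., q m\<close>. The coordinates are inner products with the
  \<open>q i\<close>, and all of them but the last vanish by integration by parts, since \<open>q i\<close> has degree \<open>i < m\<close>.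
\<close>
lemma rodrigues_factor_eq_smult_orthonormal:
  fixes q :: "nat \<Rightarrow> real poly"
  assumes deg: "\<And>j. degree (q j) = j" and nz: "\<And>j. q j \<noteq> 0"
    and orth: "\<And>i j. integral01 (bubble * q i * q j) = (if i = j then 1 else 0)"
  obtains c where "rodrigues_factor (Suc m) = smult c (q m)"
    "c\<^sup>2 = integral01 (bubble * rodrigues_factor (Suc m) * rodrigues_factor (Suc m))"
proof -
  let ?R = "rodrigues_factor (Suc m)"
  have "coeff ?R i = 0" if "i \<ge> Suc m" for i
    using that by (intro coeff_eq_0) (simp add: degree_rodrigues_factor)
  then obtain c where c: "?R = (\<Sum>j<Suc m. smult (c j) (q j))"
    using polynomial_graded_basis[OF deg nz, of "Suc m"] by blast
  have coeff: "integral01 (bubble * q i * ?R) = c i" if "i < Suc m" for i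
  proof -
    have "integral01 (bubble * q i * ?R) = (\<Sum>j<Suc m. c j * integral01 (bubble * q i * q j))"
      unfolding c sum_distrib_left integral01_sum by (simp only: mult_smult_right integral01_smult)
    also have "\<dots> = (\<Sum>j<Suc m. if i = j then c j else 0)"
      by (intro sum.cong) (simp_all add: orth)
    finally show ?thesis
      using that by simp
  qed
  have "c i = 0" if "i < m" for i
    using that coeff[of i] by (simp add: integral01_mult_rodrigues_factor_degree deg coeff_eq_0)
  then have eq: "?R = smult (c m) (q m)"
    unfolding c by simp
  have "integral01 (bubble * ?R * ?R) = (c m)\<^sup>2"
    by (simp add: eq integral01_smult orth power2_eq_square)
  with eq that show ?thesis by metis
qed

theorem theorem2p7:
  fixes e :: "nat \<Rightarrow> real poly"
  assumes deg: "\<And>k. k \<ge> 1 \<Longrightarrow> degree (e k) = k + 1"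
    and orthonormal: "\<And>i j. i \<ge> 1 \<Longrightarrow> j \<ge> 1 \<Longrightarrow>
      ((\<lambda>t. poly (e i) t * poly (e j) t / (t * (1 - t)))
         has_integral (if i = j then 1 else 0)) {0..1}"
    and lead_pos: "\<And>k. k \<ge> 1 \<Longrightarrow> lead_coeff (e k) > 0"
  shows "\<forall>k\<ge>1. \<forall>t\<in>{0..1}.
    poly (e k) t =
      1 / real k * sqrt (real k * (real k + 1) * (2 * real k + 1)) * jacobi_m1 (k + 1) (2 * t - 1)"
proof -
  have "bubble dvd e (Suc j)" for j
    using orthonormal[of "Suc j" "Suc j"]
    by (intro bubble_dvd_if_weighted_square_integrable) auto
  then obtain q where q: "\<And>j. e (Suc j) = bubble * q j"
    unfolding dvd_def by metis
  have nz: "q j \<noteq> 0" for j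
    using lead_pos[of "Suc j"] by (auto simp: q)
  have degq: "degree (q j) = j" for j
    using deg[of "Suc j"] nz[of j] by (simp add: q degree_mult_eq bubble_nonzero degree_bubble)
  \<comment> \<open>The sign flips because \<open>t (1 - t)\<close> has leading coefficient \<open>-1\<close>.\<close>
  have leadq: "coeff (q j) j < 0" for j
    using lead_pos[of "Suc j"] degq[of j] unfolding q lead_coeff_mult lead_coeff_bubble by simp
  have orth: "integral01 (bubble * q i * q j) = (if i = j then 1 else 0)" for i j
  proof -
    have "(poly (bubble * q i * q j) has_integral (if i = j then 1 else 0)) {0..1}"
      by (rule has_integral_spike_finite[where S = "{0, 1}"])
        (use orthonormal[of "Suc i" "Suc j"] in \<open>auto simp: q poly_bubble\<close>)
    then show ?thesis
      unfolding integral01_def by (rule integral_unique)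
  qed
  show ?thesis
  proof (intro allI impI ballI)
    fix k :: nat and t :: real
    assume k1: "k \<ge> 1"
    then obtain m where m: "k = Suc m"
      by (cases k) auto
    obtain c where c: "rodrigues_factor k = smult c (q m)"
      and norm_c: "c\<^sup>2 = integral01 (bubble * rodrigues_factor k * rodrigues_factor k)"
      unfolding m by (rule rodrigues_factor_eq_smult_orthonormal[OF degq nz orth])
    have c2: "c\<^sup>2 = (fact (Suc k))\<^sup>2 * (real k / ((real k + 1) * (2 * real k + 1)))"
      using norm_c by (simp only: integral01_rodrigues_factor_square[OF k1])
    \<comment> \<open>The norm determines \<open>c\<close> up to sign; the sign comes from the leading coefficients.\<close>
    have "c * coeff (q m) m = (- 1) ^ k * (fact (2 * k) / fact (k - 1))"
      using coeff_rodrigues_factor[OF k1] unfolding c by (simp only: coeff_smult m diff_Suc_1)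
    then have "(- 1) ^ k * (c * coeff (q m) m) =
        (- 1) ^ k * ((- 1) ^ k * (fact (2 * k) / fact (k - 1)))"
      by (rule arg_cong)
    also have "\<dots> = fact (2 * k) / fact (k - 1)"
      by (simp flip: power_mult_distrib mult.assoc)
    finally have "((- 1) ^ Suc k * c) * (- coeff (q m) m) = fact (2 * k) / fact (k - 1)"
      by simp
    also have "\<dots> > 0"
      by simp
    finally have "(- 1) ^ Suc k * c > 0"
      using leadq[of m] by (simp only: zero_less_mult_pos2 neg_0_less_iff_less)
    then have "(- 1) ^ Suc k * c = sqrt (((- 1) ^ Suc k * c)\<^sup>2)"
      by (simp only: real_sqrt_abs abs_of_pos)
    also have "((- 1) ^ Suc k * c)\<^sup>2 = c\<^sup>2"
      by (simp add: power_mult_distrib minus_one_power_iff)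
    also have "sqrt (c\<^sup>2) = fact (Suc k) * sqrt (real k / ((real k + 1) * (2 * real k + 1)))"
      unfolding c2 by (simp only: real_sqrt_mult) simp
    finally have factor: "(- 1) ^ Suc k * c =
        fact (Suc k) * sqrt (real k / ((real k + 1) * (2 * real k + 1)))" .
    have ek: "e k = bubble * q m"
      by (simp only: m q)
    have "jacobi_m1 (Suc k) (2 * t - 1) = ((- 1) ^ Suc k * c) / fact (Suc k) * poly (e k) t"
      by (simp add: jacobi_m1_shifted c ek del: power_Suc fact_Suc)
    also have "\<dots> = sqrt (real k / ((real k + 1) * (2 * real k + 1))) * poly (e k) t"
      unfolding factor by (simp del: fact_Suc)
    finally have jacobi: "jacobi_m1 (k + 1) (2 * t - 1) =
        sqrt (real k / ((real k + 1) * (2 * real k + 1))) * poly (e k) t"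
      by (simp only: Suc_eq_plus1)
    have "real k * (real k + 1) * (2 * real k + 1) * (real k / ((real k + 1) * (2 * real k + 1)))
        = (real k)\<^sup>2"
      using k1 by (simp add: divide_simps power2_eq_square)
    then have "sqrt (real k * (real k + 1) * (2 * real k + 1)) *
        sqrt (real k / ((real k + 1) * (2 * real k + 1))) = real k"
      by (simp flip: real_sqrt_mult)
    then have inverse: "1 / real k * sqrt (real k * (real k + 1) * (2 * real k + 1)) *
        sqrt (real k / ((real k + 1) * (2 * real k + 1))) = 1"
      using k1 by (simp only: mult.assoc) simp
    show "poly (e k) t = 1 / real k * sqrt (real k * (real k + 1) * (2 * real k + 1)) *
        jacobi_m1 (k + 1) (2 * t - 1)"
      unfolding jacobi mult.assoc[symmetric] inverse by simp
  qed
qed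

end
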